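(* Let $e$ be a positive integer, $\ell\ge 1$, and $\underline{s}=(s_0,\dots,s_{\ell-1})\in\mathbb{Z}^{\ell}$. Put $\underline{s}^{\Diamond}=(s_{\ell-1},\dots,s_0)$. Then the map $$\varphi_{e,\infty}: B_e^{\underline{s}}(\Lambda_{\underline{\mathfrak{s}}}^{+})\to B_\infty^{\underline{s}^{\Diamond}}(\omega_{\underline{s}}),\qquad \underline{\lambda}=(\lambda^{(0)},\dots,\lambda^{(\ell-1)})\longmapsto \underline{\lambda}^{\Diamond}=\lambda^{(\ell-1)}\otimes\cdots\otimes\lambda^{(0)}$$ is an embedding of crystals: it is well defined and injective, and for any $\underline{\lambda}\in B_e^{\underline{s}}(\Lambda_{\underline{\mathfrak{s}}}^{+})$ and any integers $j_1,\dots,j_r$, $$\underline{\lambda}=\widetilde{F}_{j_1}\cdots\widetilde{F}_{j_r}(\underline{\emptyset})\ \text{ in } B_e^{\underline{s}}(\Lambda_{\underline{\mathfrak{s}}}^{+})\ \Longrightarrow\ \underline{\lambda}^{\Diamond}=\widetilde{f}_{j_1}\cdots\widetilde{f}_{j_r}(\underline{\emptyset})\ \text{ in } B_\infty^{\underline{s}^{\Diamond}}(\omega_{\underline{s}}).$$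
   Context: A multipartition of length $\ell$ is an $\ell$-tuple $\underline{\lambda}=(\lambda^{(0)},\dots,\lambda^{(\ell-1)})$ of partitions; $\underline{\emptyset}$ is the empty one. A node is a triple $\gamma=(a,b,c)$: the box in row $a\ge1$ and column $b\ge1$ of component $c\in\{0,\dots,\ell-1\}$. It is removable if it belongs to $\underline{\lambda}$ and deleting it leaves a multipartition; it is addable if it is not in $\underline{\lambda}$ and adding it gives a multipartition. Given the multicharge $\underline{s}$, the content is $c(\gamma)=b-a+s_c$, and $\gamma$ is an $i$-node if $c(\gamma)\equiv i \pmod e$. Crystal $B_e^{\underline{s}}(\Lambda_{\underline{\mathfrak{s}}}^{+})$: order $i$-nodes by $\gamma_1\prec_{\underline{s}}^{+}\gamma_2$ iff $c(\gamma_1)<c(\gamma_2)$, or $c(\gamma_1)=c(\gamma_2)$ and $c_1<c_2$ (where $c_1,c_2$ are the component indices). For $i\in\{0,\dots,e-1\}$ write the addable and removable $i$-nodes of $\underline{\lambda}$ in decreasing order for $\prec_{\underline{s}}^{+}$, encode addable nodes by $A$ and removable ones by $R$, and delete factors $RA$ repeatedly until a word $A^pR^q$ remains. If $p>0$, the node of the rightmost remaining $A$ is the good $i$-node. There is an arrow $\underline{\lambda}\xrightarrow{i}\underline{\mu}$ iff $\underline{\mu}$ is obtained from $\underline{\lambda}$ by adding its good $i$-node. This defines a graph $B_e^{\underline{s},+}$ on all multipartitions of length $\ell$, and $B_e^{\underline{s}}(\Lambda_{\underline{\mathfrak{s}}}^{+})$ is the connected component of $\underline{\emptyset}$. It realizes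 the crystal graph of the irreducible $\mathcal{U}_v(\widehat{\mathfrak{sl}}_e)$-module of highest weight $\sum_k\Lambda_{s_k \bmod e}$. Labelling convention: for $j\in\mathbb{Z}$, $\widetilde{F}_j(\underline{\lambda})=\underline{\mu}$ in $B_e^{\underline{s}}(\Lambda_{\underline{\mathfrak{s}}}^{+})$ means that there is an arrow $\underline{\lambda}\xrightarrow{i}\underline{\mu}$ with $i\equiv j \pmod e$ and that the added node has content exactly $j$. Crystal $B_\infty^{\underline{t}}(\omega_{\underline{t}})$ for $\underline{t}=(t_0,\dots,t_{\ell-1})$ (type $A_\infty$): the vertices of $B_\infty(\omega_{t_0})\otimes\cdots\otimes B_\infty(\omega_{t_{\ell-1}})$ are written $\mu^{(0)}\otimes\cdots\otimes\mu^{(\ell-1)}$ with the $\mu^{(k)}$ partitions, nodes of $\mu^{(k)}$ having content $b-a+t_k$. For $j\in\mathbb{Z}$, read the addable ($A$) and removable ($R$) nodes of content exactly $j$ successively in $\mu^{(0)},\dots,\mu^{(\ell-1)}$ (each component has at most one such node) and delete factors $RA$ until a word $A^pR^q$ remains; $\widetilde{f}_j$ adds the node of the rightmost remaining $A$ (and gives $0$ if $p=0$). $B_\infty^{\underline{t}}(\omega_{\underline{t}})$ is the connected component of $\underline{\emptyset}=\emptyset\otimes\cdots\otimes\emptyset$. Since $\omega_{\underline{t}}=\sum_k\omega_{t_k}$, one has $\omega_{\underline{s}}=\omega_{\underline{s}^{\Diamond}}$. *)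

theory Defs
  imports "HOL-Number_Theory.Cong"
begin

section \<open>Multipartitions and their nodes\<close>

text \<open>Partitions are weakly decreasing lists of positive parts, and
  \<open>lam ! c\<close> is the component of index \<open>c\<close>, for \<open>0 \<le> c < length lam\<close>.
  A node \<open>(a, b, c)\<close> lies in row \<open>a \<ge> 1\<close> and column \<open>b \<ge> 1\<close> of the component \<open>c \<ge> 0\<close>.\<close>

type_synonym multipartition = "nat list list"
type_synonym node = "nat \<times> nat \<times> nat"

definition is_partition :: "nat list \<Rightarrow> bool" where
  "is_partition p \<longleftrightarrow> sorted_wrt (\<ge>) p \<and> (\<forall>x\<in>set p. x > 0)"

definition multipartitions :: "nat \<Rightarrow> multipartition set" where
  "multipartitions l = {lam. length lam = l \<and> (\<forall>p\<in>set lam. is_partition p)}"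

definition empty_mp :: "nat \<Rightarrow> multipartition" where
  "empty_mp l = replicate l []"

definition nodes :: "multipartition \<Rightarrow> node set" where
  "nodes lam = {(a, b, c). c < length lam \<and> 1 \<le> a \<and> a \<le> length (lam ! c) \<and> 1 \<le> b \<and> b \<le> lam ! c ! (a - 1)}"

definition removable :: "multipartition \<Rightarrow> node \<Rightarrow> bool" where
  "removable lam \<gamma> \<longleftrightarrow> \<gamma> \<in> nodes lam \<and> (\<exists>\<mu>\<in>multipartitions (length lam). nodes \<mu> = nodes lam - {\<gamma>})"

definition addable :: "multipartition \<Rightarrow> node \<Rightarrow> bool" where
  "addable lam \<gamma> \<longleftrightarrow> \<gamma> \<notin> nodes lam \<and> (\<exists>\<mu>\<in>multipartitions (length lam). nodes \<mu> = insert \<gamma> (nodes lam))"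

text \<open>A multipartition is determined by its length and its nodes (\<open>nodes_inject\<close> below).\<close>

definition add_node :: "node \<Rightarrow> multipartition \<Rightarrow> multipartition" where
  "add_node \<gamma> lam = (THE \<mu>. \<mu> \<in> multipartitions (length lam) \<and> nodes \<mu> = insert \<gamma> (nodes lam))"

fun comp_index :: "node \<Rightarrow> nat" where
  "comp_index (a, b, c) = c"

text \<open>The content with respect to a multicharge \<open>s\<close>, a list of length \<open>l\<close>.\<close>

fun content :: "int list \<Rightarrow> node \<Rightarrow> int" where
  "content s (a, b, c) = int b - int a + s ! c"


section \<open>Words in addable and removable nodes\<close>

datatype letter = LetA | LetR

type_synonym word = "(letter \<times> node) list"

definition signed_nodes :: "multipartition \<Rightarrow> (letter \<times> node) set" where
  "signed_nodes lam = {LetA} \<times> {\<gamma>. addable lam \<gamma>} \<union> {LetR} \<times> {\<gamma>. removable lam \<gamma>}"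

text \<open>The word that lists the elements of \<open>N\<close> in the order \<open>before\<close>.\<close>

definition reading :: "(node \<Rightarrow> node \<Rightarrow> bool) \<Rightarrow> (letter \<times> node) set \<Rightarrow> word" where
  "reading before N = (THE w. set w = N \<and> sorted_wrt (\<lambda>x y. before (snd x) (snd y)) w)"

inductive delete_RA :: "word \<Rightarrow> word \<Rightarrow> bool" where
  "delete_RA (u @ (LetR, \<gamma>) # (LetA, \<delta>) # v) (u @ v)"

definition reduced :: "word \<Rightarrow> word" where
  "reduced w = (THE v. delete_RA\<^sup>*\<^sup>* w v \<and>
     (\<exists>as rs. v = map (Pair LetA) as @ map (Pair LetR) rs))"

definition good :: "word \<Rightarrow> node option" where
  "good w = (let as = filter (\<lambda>x. fst x = LetA) (reduced w)
             in if as = [] then None else Some (snd (last as)))"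


section \<open>The connected component of a vertex in a graph\<close>

definition component :: "'v set \<Rightarrow> ('v \<Rightarrow> 'v \<Rightarrow> bool) \<Rightarrow> 'v \<Rightarrow> 'v set" where
  "component V arr v = {w. equivclp (\<lambda>x y. x \<in> V \<and> y \<in> V \<and> arr x y) v w}"

text \<open>\<open>apply_ops f [j\<^sub>1, \<dots>, j\<^sub>r] x\<close> is \<open>f\<^sub>j\<^sub>1 \<dots> f\<^sub>j\<^sub>r x\<close>, with \<open>f\<^sub>j\<^sub>r\<close> applied first; \<open>None\<close> stands
  for \<open>0\<close> or for an operator that is not defined.\<close>

fun apply_ops :: "(int \<Rightarrow> 'v \<Rightarrow> 'v option) \<Rightarrow> int list \<Rightarrow> 'v \<Rightarrow> 'v option" where
  "apply_ops f [] x = Some x"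
| "apply_ops f (j # js) x = Option.bind (apply_ops f js x) (f j)"


section \<open>The crystal of affine type\<close>

definition prec_plus :: "int list \<Rightarrow> node \<Rightarrow> node \<Rightarrow> bool" where
  "prec_plus s \<gamma> \<delta> \<longleftrightarrow> content s \<gamma> < content s \<delta> \<or> (content s \<gamma> = content s \<delta> \<and> comp_index \<gamma> < comp_index \<delta>)"

definition word_aff :: "nat \<Rightarrow> int list \<Rightarrow> int \<Rightarrow> multipartition \<Rightarrow> word" where
  "word_aff e s i lam =
     reading (\<lambda>\<gamma> \<delta>. prec_plus s \<delta> \<gamma>) {x \<in> signed_nodes lam. [content s (snd x) = i] (mod int e)}"

definition arrow_aff :: "nat \<Rightarrow> int list \<Rightarrow> int \<Rightarrow> multipartition \<Rightarrow> multipartition \<Rightarrow> bool" where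
  "arrow_aff e s i lam \<mu> \<longleftrightarrow> (\<exists>\<gamma>. good (word_aff e s i lam) = Some \<gamma> \<and> \<mu> = add_node \<gamma> lam)"

definition crystal_aff :: "nat \<Rightarrow> int list \<Rightarrow> multipartition set" where
  "crystal_aff e s = component (multipartitions (length s))
     (\<lambda>lam \<mu>. \<exists>i\<in>{0..<int e}. arrow_aff e s i lam \<mu>) (empty_mp (length s))"

definition F_op :: "nat \<Rightarrow> int list \<Rightarrow> int \<Rightarrow> multipartition \<Rightarrow> multipartition option" where
  "F_op e s j lam = (case good (word_aff e s (j mod int e) lam) of
       None \<Rightarrow> None
     | Some \<gamma> \<Rightarrow> if content s \<gamma> = j then Some (add_node \<gamma> lam) else None)"


section \<open>The crystal of type \<open>A\<^sub>\<infinity>\<close>\<close>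

text \<open>The vertex \<open>\<mu>\<^sup>(\<^sup>0\<^sup>) \<otimes> \<dots> \<otimes> \<mu>\<^sup>(\<^sup>l\<^sup>-\<^sup>1\<^sup>)\<close> is the list of its tensor factors,
  that is, a multipartition of length \<open>l\<close>. Reversing the order of the components, both of a
  multipartition and of a multicharge, is therefore \<open>rev\<close>.\<close>

definition word_inf :: "int list \<Rightarrow> int \<Rightarrow> multipartition \<Rightarrow> word" where
  "word_inf t j \<mu> =
     reading (\<lambda>\<gamma> \<delta>. comp_index \<gamma> < comp_index \<delta>) {x \<in> signed_nodes \<mu>. content t (snd x) = j}"

definition f_op :: "int list \<Rightarrow> int \<Rightarrow> multipartition \<Rightarrow> multipartition option" where
  "f_op t j \<mu> = map_option (\<lambda>\<gamma>. add_node \<gamma> \<mu>) (good (word_inf t j \<mu>))"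

definition crystal_inf :: "int list \<Rightarrow> multipartition set" where
  "crystal_inf t = component (multipartitions (length t))
     (\<lambda>\<mu> \<nu>. \<exists>j. f_op t j \<mu> = Some \<nu>) (empty_mp (length t))"


section \<open>The notions above are well defined\<close>

lemma nodes_inject:
  assumes "\<mu> \<in> multipartitions l" "\<nu> \<in> multipartitions l" "nodes \<mu> = nodes \<nu>"
  shows "\<mu> = \<nu>"
proof (rule nth_equalityI)
  show len: "length \<mu> = length \<nu>"
    using assms by (simp add: multipartitions_def)
  fix c assume c: "c < length \<mu>"
  have pos: "0 < \<kappa> ! c ! a" if "\<kappa> \<in> {\<mu>, \<nu>}" "a < length (\<kappa> ! c)" for \<kappa> a
  proof -
    have "\<kappa> ! c \<in> set \<kappa>" using that c len by auto
    then show ?thesis using that assms(1,2) nth_mem[OF that(2)]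
      by (auto simp: multipartitions_def is_partition_def)
  qed
  have mem: "(a, b, c) \<in> nodes \<kappa> \<longleftrightarrow> 1 \<le> a \<and> a \<le> length (\<kappa> ! c) \<and> 1 \<le> b \<and> b \<le> \<kappa> ! c ! (a - 1)"
    if "\<kappa> \<in> {\<mu>, \<nu>}" for \<kappa> a b
    using that c len by (auto simp: nodes_def)
  have L: "{a. (a, 1, c) \<in> nodes \<kappa>} = {1..length (\<kappa> ! c)}" if "\<kappa> \<in> {\<mu>, \<nu>}" for \<kappa>
    using pos[OF that] mem[OF that] by (force simp: Suc_le_eq)
  have "{1..length (\<mu> ! c)} = {1..length (\<nu> ! c)}"
    using L[of \<mu>] L[of \<nu>] assms(3) by simp
  then have len2: "length (\<mu> ! c) = length (\<nu> ! c)"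
    by (metis card_atLeastAtMost diff_Suc_1)
  show "\<mu> ! c = \<nu> ! c"
  proof (rule nth_equalityI)
    fix a assume a: "a < length (\<mu> ! c)"
    have "{b. (Suc a, b, c) \<in> nodes \<kappa>} = {1..\<kappa> ! c ! a}" if "\<kappa> \<in> {\<mu>, \<nu>}" for \<kappa>
      using mem[OF that] that a len2 by auto
    from this[of \<mu>] this[of \<nu>] have "{1..\<mu> ! c ! a} = {1..\<nu> ! c ! a}"
      unfolding assms(3) by blast
    then show "\<mu> ! c ! a = \<nu> ! c ! a"
      by (metis card_atLeastAtMost diff_Suc_1)
  qed (rule len2)
qed

lemma add_node_properties:
  assumes "addable lam \<gamma>"
  shows "add_node \<gamma> lam \<in> multipartitions (length lam)"
    and "nodes (add_node \<gamma> lam) = insert \<gamma> (nodes lam)"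
proof -
  have "\<exists>!\<mu>. \<mu> \<in> multipartitions (length lam) \<and> nodes \<mu> = insert \<gamma> (nodes lam)"
    using assms nodes_inject[of _ "length lam"] unfolding addable_def by metis
  from theI'[OF this]
  show "add_node \<gamma> lam \<in> multipartitions (length lam)"
    "nodes (add_node \<gamma> lam) = insert \<gamma> (nodes lam)"
    by (simp_all add: add_node_def)
qed

lemma nodes_down_closed:
  assumes "lam \<in> multipartitions l" "(a, b, c) \<in> nodes lam" "1 \<le> a'" "a' \<le> a" "1 \<le> b'" "b' \<le> b"
  shows "(a', b', c) \<in> nodes lam"
proof -
  have c: "c < length lam" "1 \<le> a" "a \<le> length (lam ! c)" "b \<le> lam ! c ! (a - 1)"
    using assms(2) by (auto simp: nodes_def)
  have "sorted_wrt (\<ge>) (lam ! c)"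
    using assms(1) c(1) by (auto simp: multipartitions_def is_partition_def)
  then have "lam ! c ! (a - 1) \<le> lam ! c ! (a' - 1)"
    using sorted_wrt_nth_less[of "(\<ge>)" "lam ! c" "a' - 1" "a - 1"] c assms(3,4)
    by (cases "a' = a") auto
  then show ?thesis using c assms by (auto simp: nodes_def)
qed

lemma finite_nodes: "finite (nodes lam)"
proof -
  have "nodes lam \<subseteq> (\<Union>c<length lam. \<Union>a\<in>{1..length (lam ! c)}. \<Union>b\<in>{1..lam ! c ! (a - 1)}. {(a, b, c)})"
    by (auto simp: nodes_def)
  then show ?thesis by (rule finite_subset) auto
qed

lemma finite_addable:
  shows "finite {\<gamma>. addable lam \<gamma>}"
proof -
  have "{\<gamma>. addable lam \<gamma>} \<subseteq> (\<lambda>(a, b, c). (Suc a, b, c)) ` nodes lam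
    \<union> (\<lambda>(a, b, c). (a, Suc b, c)) ` nodes lam \<union> (\<lambda>c. (1, 1, c)) ` {..<length lam}"
  proof
    fix \<gamma> assume "\<gamma> \<in> {\<gamma>. addable lam \<gamma>}"
    then obtain \<mu> where \<mu>: "\<mu> \<in> multipartitions (length lam)" "nodes \<mu> = insert \<gamma> (nodes lam)"
      by (auto simp: addable_def)
    obtain a b c where \<gamma>: "\<gamma> = (a, b, c)" by (cases \<gamma>)
    have in\<mu>: "(a, b, c) \<in> nodes \<mu>" using \<mu> \<gamma> by simp
    then have ab: "1 \<le> a" "1 \<le> b" "c < length lam"
      using \<mu>(1) by (auto simp: nodes_def multipartitions_def)
    consider "a \<ge> 2" | "b \<ge> 2" | "a = 1" "b = 1" using ab by linarith
    then show "\<gamma> \<in> (\<lambda>(a, b, c). (Suc a, b, c)) ` nodes lam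
      \<union> (\<lambda>(a, b, c). (a, Suc b, c)) ` nodes lam \<union> (\<lambda>c. (1, 1, c)) ` {..<length lam}"
    proof cases
      case 1
      have "(a - 1, b, c) \<in> nodes \<mu>"
        by (rule nodes_down_closed[OF \<mu>(1) in\<mu>]) (use 1 ab in auto)
      then have "(a - 1, b, c) \<in> nodes lam" using \<mu> \<gamma> 1 by auto
      moreover have "\<gamma> = (\<lambda>(a, b, c). (Suc a, b, c)) (a - 1, b, c)" using \<gamma> 1 by simp
      ultimately show ?thesis by blast
    next
      case 2
      have "(a, b - 1, c) \<in> nodes \<mu>"
        by (rule nodes_down_closed[OF \<mu>(1) in\<mu>]) (use 2 ab in auto)
      then have "(a, b - 1, c) \<in> nodes lam" using \<mu> \<gamma> 2 by auto
      moreover have "\<gamma> = (\<lambda>(a, b, c). (a, Suc b, c)) (a, b - 1, c)" using \<gamma> 2 by simp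
      ultimately show ?thesis by blast
    next
      case 3
      then show ?thesis using \<gamma> ab by auto
    qed
  qed
  then show ?thesis by (rule finite_subset) (auto intro: finite_nodes)
qed

lemma finite_signed_nodes: "finite (signed_nodes lam)"
proof -
  have "{\<gamma>. removable lam \<gamma>} \<subseteq> nodes lam" by (auto simp: removable_def)
  then have "finite {\<gamma>. removable lam \<gamma>}" using finite_nodes finite_subset by blast
  then show ?thesis using finite_addable by (auto simp: signed_nodes_def)
qed

text \<open>On each diagonal of each component there is at most one addable or removable node.\<close>

lemma signed_nodes_diagonal_aux:
  assumes lam: "lam \<in> multipartitions l"
    and x: "addable lam (a, b, c) \<or> removable lam (a, b, c)"
    and y: "addable lam (a + k, b + k, c) \<or> removable lam (a + k, b + k, c)"
  shows "k = 0"
proof (rule ccontr)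
  assume k: "k \<noteq> 0"
  have ge: "1 \<le> a" "1 \<le> b"
  proof -
    from x obtain \<mu> where "(a, b, c) \<in> nodes \<mu>"
      by (auto simp: addable_def removable_def)
    then show "1 \<le> a" "1 \<le> b" by (auto simp: nodes_def)
  qed
  have *: "(a, b, c) \<in> nodes lam \<and> (Suc a, b, c) \<in> nodes lam"
  proof (cases "(a + k, b + k, c) \<in> nodes lam")
    case True
    show ?thesis
      by (intro conjI nodes_down_closed[OF lam True]) (use ge k in auto)
  next
    case False
    then obtain \<mu> where \<mu>: "\<mu> \<in> multipartitions (length lam)"
      "nodes \<mu> = insert (a + k, b + k, c) (nodes lam)"
      using y by (auto simp: addable_def removable_def)
    then have in\<mu>: "(a + k, b + k, c) \<in> nodes \<mu>" by simp
    have "(a, b, c) \<in> nodes \<mu> \<and> (Suc a, b, c) \<in> nodes \<mu>"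
      by (intro conjI nodes_down_closed[OF \<mu>(1) in\<mu>]) (use ge k in auto)
    then show ?thesis using \<mu> k by auto
  qed
  then obtain \<mu> where \<mu>: "\<mu> \<in> multipartitions (length lam)" "nodes \<mu> = nodes lam - {(a, b, c)}"
    using x by (auto simp: addable_def removable_def)
  then have "(Suc a, b, c) \<in> nodes \<mu>" using * by auto
  from nodes_down_closed[OF \<mu>(1) this, of a b] have "(a, b, c) \<in> nodes \<mu>" using ge by simp
  then show False using \<mu> by simp
qed

lemma signed_nodes_diagonal:
  assumes "lam \<in> multipartitions l" "x \<in> signed_nodes lam" "y \<in> signed_nodes lam"
    and "content s (snd x) = content s (snd y)" "comp_index (snd x) = comp_index (snd y)"
  shows "x = y"
proof -
  obtain p a b c where x: "x = (p, a, b, c)" by (cases x)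
  obtain q a' b' c' where y: "y = (q, a', b', c')" by (cases y)
  have c: "c' = c" and d: "int b - int a = int b' - int a'" using assms(4,5) x y by simp_all
  have ax: "addable lam (a, b, c) \<or> removable lam (a, b, c)"
    and ay: "addable lam (a', b', c) \<or> removable lam (a', b', c)"
    using assms(2,3) x y c by (auto simp: signed_nodes_def)
  have "a = a' \<and> b = b'"
  proof (cases "a \<le> a'")
    case True
    then have "a' = a + (a' - a)" "b' = b + (a' - a)" using d by linarith+
    then show ?thesis using signed_nodes_diagonal_aux[OF assms(1) ax] ay by (metis add_0_right)
  next
    case False
    then have "a = a' + (a - a')" "b = b' + (a - a')" using d by linarith+
    then show ?thesis using signed_nodes_diagonal_aux[OF assms(1) ay] ax by (metis add_0_right)
  qed
  moreover have "p = q"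
    using assms(2,3) x y c calculation by (auto simp: signed_nodes_def addable_def removable_def)
  ultimately show ?thesis using x y c by simp
qed

lemma reading_ex1:
  assumes "finite N"
    and irrefl: "\<And>x. x \<in> N \<Longrightarrow> \<not> before (snd x) (snd x)"
    and trans: "\<And>\<gamma> \<delta> \<epsilon>. before \<gamma> \<delta> \<Longrightarrow> before \<delta> \<epsilon> \<Longrightarrow> before \<gamma> \<epsilon>"
    and total: "\<And>x y. x \<in> N \<Longrightarrow> y \<in> N \<Longrightarrow> x \<noteq> y \<Longrightarrow> before (snd x) (snd y) \<or> before (snd y) (snd x)"
  shows "\<exists>!w. set w = N \<and> sorted_wrt (\<lambda>x y. before (snd x) (snd y)) w"
  using assms(1) irrefl total
proof (induction "card N" arbitrary: N)
  case 0
  then show ?case by (auto intro!: ex1I[of _ "[]"])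
next
  case (Suc n)
  let ?r = "\<lambda>x y. before (snd x) (snd y)"
  have "\<exists>x\<in>N. \<forall>y\<in>N. y \<noteq> x \<longrightarrow> ?r x y"
  proof -
    have "\<exists>x\<in>M. \<forall>y\<in>M. y \<noteq> x \<longrightarrow> ?r x y" if "finite M" "M \<noteq> {}" "M \<subseteq> N" for M
      using that
    proof (induction rule: finite_ne_induct)
      case (insert z M)
      then obtain x where x: "x \<in> M" "\<forall>y\<in>M. y \<noteq> x \<longrightarrow> ?r x y" by auto
      have "z \<noteq> x" "z \<in> N" "x \<in> N" using insert x by auto
      then consider "?r z x" | "?r x z" using Suc.prems(3) by blast
      then show ?case
      proof cases
        case 1
        then have "\<forall>y\<in>M. ?r z y" using x trans by metis
        then show ?thesis by auto
      qed (use x in auto)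
    qed simp
    then show ?thesis using Suc.prems(1) Suc.hyps(2) by (metis card.empty nat.distinct(1) subset_refl)
  qed
  then obtain x where x: "x \<in> N" "\<And>y. y \<in> N \<Longrightarrow> y \<noteq> x \<Longrightarrow> ?r x y" by blast
  have "\<exists>!w. set w = N - {x} \<and> sorted_wrt ?r w"
    using Suc.hyps(2) Suc.prems x(1) by (intro Suc.hyps(1)) auto
  then obtain w where w0: "set w = N - {x} \<and> sorted_wrt ?r w"
    and w1: "\<forall>v. set v = N - {x} \<and> sorted_wrt ?r v \<longrightarrow> v = w" by (rule ex1E)
  have w: "set w = N - {x}" "sorted_wrt ?r w" by (rule conjunct1[OF w0], rule conjunct2[OF w0])
  have uniq: "v = w" if "set v = N - {x}" "sorted_wrt ?r v" for v
    using w1[rule_format, OF conjI[OF that]] .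
  show ?case
  proof (rule ex1I[of _ "x # w"])
    show "set (x # w) = N \<and> sorted_wrt ?r (x # w)" using w x by auto
  next
    fix v assume v: "set v = N \<and> sorted_wrt ?r v"
    then obtain z v' where zv: "v = z # v'" using x(1) by (cases v) auto
    have "z = x"
    proof (rule ccontr)
      assume "z \<noteq> x"
      moreover have "z \<in> N" "x \<in> set v" using v zv x(1) by auto
      ultimately have "?r x z" "?r z x" using x(2)[of z] v zv by auto
      then show False using trans Suc.prems(2) x(1) by blast
    qed
    have "\<forall>y\<in>set v'. ?r x y" using v zv \<open>z = x\<close> by simp
    then have "x \<notin> set v'" using Suc.prems(2)[OF x(1)] by blast
    then have "set v' = N - {x}" "sorted_wrt ?r v'" using v zv \<open>z = x\<close> by auto
    then have "v' = w" by (rule uniq)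
    then show "v = x # w" using zv \<open>z = x\<close> by simp
  qed
qed

lemma word_aff_properties:
  assumes "lam \<in> multipartitions l"
  shows "set (word_aff e s i lam) = {x \<in> signed_nodes lam. [content s (snd x) = i] (mod int e)}"
    and "sorted_wrt (\<lambda>x y. prec_plus s (snd y) (snd x)) (word_aff e s i lam)"
proof -
  have "\<exists>!w. set w = {x \<in> signed_nodes lam. [content s (snd x) = i] (mod int e)}
    \<and> sorted_wrt (\<lambda>x y. prec_plus s (snd y) (snd x)) w"
  proof (rule reading_ex1[where before = "\<lambda>\<gamma> \<delta>. prec_plus s \<delta> \<gamma>"])
    fix x y
    assume "x \<in> {x \<in> signed_nodes lam. [content s (snd x) = i] (mod int e)}"
      "y \<in> {x \<in> signed_nodes lam. [content s (snd x) = i] (mod int e)}" "x \<noteq> y"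
    then have "content s (snd x) \<noteq> content s (snd y) \<or> comp_index (snd x) \<noteq> comp_index (snd y)"
      using signed_nodes_diagonal[OF assms, of x y s] by auto
    then show "prec_plus s (snd y) (snd x) \<or> prec_plus s (snd x) (snd y)"
      unfolding prec_plus_def by linarith
  qed (auto simp: finite_signed_nodes prec_plus_def)
  from theI'[OF this]
  show "set (word_aff e s i lam) = {x \<in> signed_nodes lam. [content s (snd x) = i] (mod int e)}"
    "sorted_wrt (\<lambda>x y. prec_plus s (snd y) (snd x)) (word_aff e s i lam)"
    by (simp_all add: word_aff_def reading_def)
qed

lemma word_inf_properties:
  assumes "\<mu> \<in> multipartitions l"
  shows "set (word_inf t j \<mu>) = {x \<in> signed_nodes \<mu>. content t (snd x) = j}"
    and "sorted_wrt (\<lambda>x y. comp_index (snd x) < comp_index (snd y)) (word_inf t j \<mu>)"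
proof -
  have "\<exists>!w. set w = {x \<in> signed_nodes \<mu>. content t (snd x) = j}
    \<and> sorted_wrt (\<lambda>x y. comp_index (snd x) < comp_index (snd y)) w"
  proof (rule reading_ex1[where before = "\<lambda>\<gamma> \<delta>. comp_index \<gamma> < comp_index \<delta>"])
    fix x y
    assume "x \<in> {x \<in> signed_nodes \<mu>. content t (snd x) = j}"
      "y \<in> {x \<in> signed_nodes \<mu>. content t (snd x) = j}" "x \<noteq> y"
    then have "comp_index (snd x) \<noteq> comp_index (snd y)"
      using signed_nodes_diagonal[OF assms, of x y t] by auto
    then show "comp_index (snd x) < comp_index (snd y) \<or> comp_index (snd y) < comp_index (snd x)"
      by linarith
  qed (auto simp: finite_signed_nodes)
  from theI'[OF this]
  show "set (word_inf t j \<mu>) = {x \<in> signed_nodes \<mu>. content t (snd x) = j}"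
    "sorted_wrt (\<lambda>x y. comp_index (snd x) < comp_index (snd y)) (word_inf t j \<mu>)"
    by (simp_all add: word_inf_def reading_def)
qed

lemma delete_RA_Cons: "delete_RA v w \<Longrightarrow> delete_RA (x # v) (x # w)"
  by (induction rule: delete_RA.induct) (metis append_Cons delete_RA.intros)

lemma reduction_exists:
  "\<exists>as rs. delete_RA\<^sup>*\<^sup>* w (map (Pair LetA) as @ map (Pair LetR) rs)"
proof (induction w)
  case Nil
  show ?case by (rule exI[of _ "[]"], rule exI[of _ "[]"]) simp
next
  case (Cons x w)
  then obtain as rs where *: "delete_RA\<^sup>*\<^sup>* w (map (Pair LetA) as @ map (Pair LetR) rs)" by blast
  have **: "delete_RA\<^sup>*\<^sup>* (x # w) (x # map (Pair LetA) as @ map (Pair LetR) rs)"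
    using * by (induction rule: rtranclp_induct) (auto intro: rtranclp.rtrancl_into_rtrancl delete_RA_Cons)
  obtain p \<gamma> where x: "x = (p, \<gamma>)" by (cases x)
  show ?case
  proof (cases p)
    case LetA
    show ?thesis using ** x LetA by (intro exI[of _ "\<gamma> # as"] exI[of _ rs]) simp
  next
    case LetR
    show ?thesis
    proof (cases as)
      case Nil
      show ?thesis using ** x LetR Nil by (intro exI[of _ "[]"] exI[of _ "\<gamma> # rs"]) simp
    next
      case (Cons \<delta> as')
      have "delete_RA (x # map (Pair LetA) as @ map (Pair LetR) rs) (map (Pair LetA) as' @ map (Pair LetR) rs)"
        using delete_RA.intros[of "[]" \<gamma> \<delta>] x LetR Cons by simp
      then show ?thesis using ** by (meson rtranclp.rtrancl_into_rtrancl)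
    qed
  qed
qed

text \<open>The reduced word computed by a recursive scan from the right; it is invariant under deletion,
  so that the result of deleting factors \<open>RA\<close> does not depend on the order of the deletions.\<close>

fun scan :: "word \<Rightarrow> word" where
  "scan [] = []"
| "scan (x # w) = (case scan w of
      [] \<Rightarrow> [x]
    | y # v \<Rightarrow> if fst x = LetR \<and> fst y = LetA then v else x # y # v)"

lemma scan_append: "scan v = scan w \<Longrightarrow> scan (u @ v) = scan (u @ w)"
  by (induction u) auto

lemma scan_form: "\<exists>as rs. scan w = map (Pair LetA) as @ map (Pair LetR) rs"
proof (induction w)
  case (Cons x w)
  then obtain as rs where *: "scan w = map (Pair LetA) as @ map (Pair LetR) rs" by blast
  obtain p \<gamma> where x: "x = (p, \<gamma>)" by (cases x)
  show ?case
  proof (cases p)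
    case LetA
    then have "scan (x # w) = map (Pair LetA) (\<gamma> # as) @ map (Pair LetR) rs"
      using * x by (auto split: list.split)
    then show ?thesis by blast
  next
    case LetR
    show ?thesis
    proof (cases as)
      case Nil
      then have "scan (x # w) = map (Pair LetA) [] @ map (Pair LetR) (\<gamma> # rs)"
        using * x LetR by (auto split: list.split)
      then show ?thesis by blast
    next
      case (Cons \<delta> as')
      then have "scan (x # w) = map (Pair LetA) as' @ map (Pair LetR) rs"
        using * x LetR by simp
      then show ?thesis by blast
    qed
  qed
qed simp

lemma scan_RA: "scan ((LetR, \<gamma>) # (LetA, \<delta>) # v) = scan v"
  by (auto split: list.split)

lemma scan_delete_RA: "delete_RA\<^sup>*\<^sup>* w v \<Longrightarrow> scan w = scan v"
proof (induction rule: rtranclp_induct)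
  case (step y z)
  from step(2) have "scan y = scan z"
    by cases (simp only: scan_append[OF scan_RA])
  then show ?case using step by simp
qed simp

lemma scan_reduced:
  "scan (map (Pair LetA) as @ map (Pair LetR) rs) = map (Pair LetA) as @ map (Pair LetR) rs"
proof -
  have "scan (map (Pair LetR) rs) = map (Pair LetR) rs"
    by (induction rs) (auto split: list.split)
  then show ?thesis by (induction as) (auto split: list.split)
qed

lemma reduced_eq_scan: "reduced w = scan w"
  unfolding reduced_def
proof (rule the_equality)
  obtain as rs where *: "delete_RA\<^sup>*\<^sup>* w (map (Pair LetA) as @ map (Pair LetR) rs)"
    using reduction_exists by blast
  then have "scan w = map (Pair LetA) as @ map (Pair LetR) rs"
    using scan_delete_RA scan_reduced by metis
  then show "delete_RA\<^sup>*\<^sup>* w (scan w) \<and> (\<exists>as rs. scan w = map (Pair LetA) as @ map (Pair LetR) rs)"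
    using * by auto
next
  fix v assume "delete_RA\<^sup>*\<^sup>* w v \<and> (\<exists>as rs. v = map (Pair LetA) as @ map (Pair LetR) rs)"
  then show "v = scan w" using scan_delete_RA scan_reduced by metis
qed

lemma F_op_eq_Some_iff:
  assumes "e > 0"
  shows "F_op e s j lam = Some \<mu> \<longleftrightarrow>
    (\<exists>i\<in>{0..<int e}. \<exists>\<gamma>. [i = j] (mod int e) \<and> good (word_aff e s i lam) = Some \<gamma>
       \<and> content s \<gamma> = j \<and> \<mu> = add_node \<gamma> lam)"
proof -
  have *: "i \<in> {0..<int e} \<and> [i = j] (mod int e) \<longleftrightarrow> i = j mod int e" for i
    using assms by (auto simp: cong_def)
  have "F_op e s j lam = Some \<mu> \<longleftrightarrow> (\<exists>\<gamma>. good (word_aff e s (j mod int e) lam) = Some \<gamma>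
      \<and> content s \<gamma> = j \<and> \<mu> = add_node \<gamma> lam)"
    unfolding F_op_def by (cases "good (word_aff e s (j mod int e) lam)") auto
  then show ?thesis using * by metis
qed

end

theory Submission
  imports Defs
begin

text \<open>The word of \<open>i\<close>-nodes for the affine crystal is the concatenation, over the contents
  \<open>j \<equiv> i (mod e)\<close> in decreasing order, of the words of nodes of content \<open>j\<close>, and in each of these
  factors the components are read from the last one to the first one. Reversing the components turns
  the factor of content \<open>j\<close> into the word that defines \<open>f\<^sub>j\<close>. A letter \<open>A\<close> is the rightmost surviving
  one iff no \<open>R\<close> survives in the reduction of the prefix before it and no \<open>A\<close> survives in the reduction
  of the suffix after it; this property passes to every factor containing the letter.
  So the good \<open>i\<close>-node, if it has content \<open>j\<close>, is also the node added by \<open>f\<^sub>j\<close>. Hence reversal maps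
  arrows to arrows, and connected components into connected components.\<close>

section \<open>Good letters of factors of a word\<close>

text \<open>The deletions reducing \<open>p\<close> can be made inside \<open>p @ v\<close>, and
  \<open>scan\<close> is invariant under them. No \<open>R\<close> is then left before
  \<open>v\<close>, and leading \<open>A\<close>s never cancel.\<close>

lemma scan_append_LetA:
  assumes "scan p = map (Pair LetA) as"
  shows "scan (p @ v) = map (Pair LetA) as @ scan v"
proof -
  have mono: "delete_RA\<^sup>*\<^sup>* (x @ v) (y @ v)" if "delete_RA\<^sup>*\<^sup>* x y" for x y
    using that
  proof (induction rule: rtranclp_induct)
    case (step y z)
    from step(2) have "delete_RA (y @ v) (z @ v)"
      by cases (metis append.assoc append_Cons delete_RA.intros)
    then show ?case using step.IH by simp
  qed simp
  obtain as' rs where *: "delete_RA\<^sup>*\<^sup>* p (map (Pair LetA) as' @ map (Pair LetR) rs)"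
    using reduction_exists by blast
  then have "scan p = map (Pair LetA) as' @ map (Pair LetR) rs"
    using scan_delete_RA scan_reduced by metis
  then have "delete_RA\<^sup>*\<^sup>* p (map (Pair LetA) as)" using * assms by simp
  from scan_delete_RA[OF mono[OF this]]
  have "scan (p @ v) = scan (map (Pair LetA) as @ v)" .
  also have "\<dots> = map (Pair LetA) as @ scan v"
    by (induction as) (auto split: list.split)
  finally show ?thesis .
qed

lemma scan_Cons_LetA: "scan ((LetA, \<gamma>) # w) = (LetA, \<gamma>) # scan w"
  by (auto split: list.split)

text \<open>Locates a surviving \<open>A\<close> in the word itself. The induction varies
  \<open>as\<close>, because a cancelled \<open>R\<close> in front means one more \<open>A\<close>
  in the scan of the tail.\<close>

lemma scan_surviving_LetA:
  assumes "scan w = map (Pair LetA) as @ (LetA, \<gamma>) # z"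
  shows "\<exists>p q. w = p @ (LetA, \<gamma>) # q \<and> scan p = map (Pair LetA) as \<and> scan q = z"
  using assms
proof (induction w arbitrary: as)
  case (Cons x w)
  obtain k \<delta> where x: "x = (k, \<delta>)" by (cases x)
  show ?case
  proof (cases k)
    case LetA
    show ?thesis
    proof (cases as)
      case Nil
      then have "x = (LetA, \<gamma>)" "scan w = z" using Cons.prems x LetA scan_Cons_LetA by auto
      then show ?thesis using Nil by (intro exI[of _ "[]"] exI[of _ w]) simp
    next
      case (Cons \<alpha> as')
      then have "\<delta> = \<alpha>" "scan w = map (Pair LetA) as' @ (LetA, \<gamma>) # z"
        using Cons.prems x LetA scan_Cons_LetA by auto
      with Cons.IH obtain p q where "w = p @ (LetA, \<gamma>) # q" "scan p = map (Pair LetA) as'" "scan q = z"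
        by blast
      then show ?thesis using x LetA \<open>\<delta> = \<alpha>\<close> Cons
        by (intro exI[of _ "x # p"] exI[of _ q]) (simp only: scan_Cons_LetA append_Cons list.map simp_thms)
    qed
  next
    case LetR
    \<comment> \<open>An uncancelled \<open>R\<close> would stand at the head of
      \<open>scan (x # w)\<close>, which starts with an \<open>A\<close>.\<close>
    have "\<exists>\<beta>. scan w = (LetA, \<beta>) # scan (x # w)"
    proof (cases "scan w")
      case Nil
      then show ?thesis using Cons.prems x LetR by (cases as) auto
    next
      case (Cons y v)
      then show ?thesis using Cons.prems x LetR by (cases y; cases as) (auto split: if_splits)
    qed
    then obtain \<beta> where "scan w = map (Pair LetA) (\<beta> # as) @ (LetA, \<gamma>) # z"
      using Cons.prems by auto
    with Cons.IH obtain p q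
      where "w = p @ (LetA, \<gamma>) # q" "scan p = map (Pair LetA) (\<beta> # as)" "scan q = z" by blast
    then show ?thesis using x LetR by (intro exI[of _ "x # p"] exI[of _ q]) simp
  qed
qed simp

text \<open>Prepending a letter can cancel an \<open>A\<close> but never an \<open>R\<close>, so an
  \<open>R\<close> surviving in \<open>v\<close> would survive in \<open>u @ v\<close>.\<close>

lemma scan_suffix_LetA:
  assumes "scan (u @ v) = map (Pair LetA) as"
  shows "\<exists>bs. scan v = map (Pair LetA) bs"
  using assms
proof (induction u arbitrary: as)
  case (Cons x u)
  have "\<exists>bs. scan (u @ v) = map (Pair LetA) bs"
  proof (cases "scan (u @ v)")
    case (Cons y z)
    show ?thesis
    proof (cases "fst x = LetR \<and> fst y = LetA")
      case True
      then have "scan (u @ v) = map (Pair LetA) (snd y # as)"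
        using Cons Cons.prems by (cases y) auto
      then show ?thesis by blast
    next
      case False
      then have "x # scan (u @ v) = map (Pair LetA) as" using Cons Cons.prems by auto
      then show ?thesis by (cases as) auto
    qed
  qed simp
  then show ?case using Cons.IH by blast
qed auto

text \<open>The leftmost \<open>A\<close> surviving in \<open>u\<close> follows a prefix that
  reduces to the empty word, so no extension to the right can cancel it.\<close>

lemma scan_prefix_LetR:
  assumes "scan (u @ v) = map (Pair LetR) rs"
  shows "\<exists>rs'. scan u = map (Pair LetR) rs'"
proof -
  obtain as rs' where *: "scan u = map (Pair LetA) as @ map (Pair LetR) rs'"
    using scan_form by blast
  have "as = []"
  proof (cases as)
    case (Cons \<gamma> as')
    then have "scan u = map (Pair LetA) [] @ (LetA, \<gamma>) # map (Pair LetA) as' @ map (Pair LetR) rs'"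
      using * by simp
    from scan_surviving_LetA[OF this] obtain p q
      where "u = p @ (LetA, \<gamma>) # q" "scan p = map (Pair LetA) []" by blast
    then have "scan (u @ v) = (LetA, \<gamma>) # scan (q @ v)"
      using scan_append_LetA[of p "[]"] scan_Cons_LetA by simp
    then show ?thesis using assms by (cases rs) auto
  qed
  then show ?thesis using * by auto
qed

text \<open>Describes the two sides of the good letter separately, so that the suffix and prefix
  lemmas can be applied to one side each.\<close>

lemma good_eq_Some_iff:
  "good w = Some \<gamma> \<longleftrightarrow> (\<exists>p q as rs. w = p @ (LetA, \<gamma>) # q
     \<and> scan p = map (Pair LetA) as \<and> scan q = map (Pair LetR) rs)"
proof
  assume g: "good w = Some \<gamma>"
  obtain as rs where s: "scan w = map (Pair LetA) as @ map (Pair LetR) rs"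
    using scan_form by blast
  have "filter (\<lambda>x. fst x = LetA) (scan w) = map (Pair LetA) as" unfolding s by simp
  then have "as \<noteq> []" "last as = \<gamma>"
    using g by (auto simp: good_def reduced_eq_scan Let_def last_map split: if_splits)
  then have "scan w = map (Pair LetA) (butlast as) @ (LetA, \<gamma>) # map (Pair LetR) rs"
    using s by (cases as rule: rev_cases) auto
  then show "\<exists>p q as rs. w = p @ (LetA, \<gamma>) # q
     \<and> scan p = map (Pair LetA) as \<and> scan q = map (Pair LetR) rs"
    using scan_surviving_LetA by blast
next
  assume "\<exists>p q as rs. w = p @ (LetA, \<gamma>) # q
     \<and> scan p = map (Pair LetA) as \<and> scan q = map (Pair LetR) rs"
  then obtain p q as rs where "w = p @ (LetA, \<gamma>) # q" "scan p = map (Pair LetA) as"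
    "scan q = map (Pair LetR) rs" by blast
  then have "scan w = map (Pair LetA) as @ (LetA, \<gamma>) # map (Pair LetR) rs"
    using scan_append_LetA scan_Cons_LetA by metis
  then show "good w = Some \<gamma>"
    by (simp add: good_def reduced_eq_scan Let_def)
qed

lemma good_in_set: "good w = Some \<gamma> \<Longrightarrow> (LetA, \<gamma>) \<in> set w"
  by (auto simp: good_eq_Some_iff)

lemma sorted_filter_trichotomy:
  fixes f :: "'a \<Rightarrow> 'b::linorder"
  assumes "sorted_wrt (\<lambda>x y. f y \<le> f x) w"
  shows "filter (\<lambda>x. j < f x) w @ filter (\<lambda>x. f x = j) w @ filter (\<lambda>x. f x < j) w = w"
  using assms
proof (induction w)
  case (Cons x w)
  then have IH: "filter (\<lambda>x. j < f x) w @ filter (\<lambda>x. f x = j) w @ filter (\<lambda>x. f x < j) w = w"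
    and le: "\<And>y. y \<in> set w \<Longrightarrow> f y \<le> f x" by auto
  have 1: "filter (\<lambda>y. j < f y) w = []" if "f x \<le> j"
    using le that by (force simp: filter_empty_conv)
  have 2: "filter (\<lambda>y. f y = j) w = []" if "f x < j"
    using le that by (force simp: filter_empty_conv)
  consider "j < f x" | "f x = j" | "f x < j" by fastforce
  then show ?case using IH 1 2 by cases auto
qed simp

lemma good_filter:
  fixes f :: "letter \<times> node \<Rightarrow> int"
  assumes "good w = Some \<gamma>" and sorted: "sorted_wrt (\<lambda>x y. f y \<le> f x) w" and j: "f (LetA, \<gamma>) = j"
  shows "good (filter (\<lambda>x. f x = j) w) = Some \<gamma>"
proof -
  obtain p q as rs where w: "w = p @ (LetA, \<gamma>) # q" and p: "scan p = map (Pair LetA) as"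
    and q: "scan q = map (Pair LetR) rs"
    using assms(1) good_eq_Some_iff by blast
  have "sorted_wrt (\<lambda>x y. f y \<le> f x) p" "sorted_wrt (\<lambda>x y. f y \<le> f x) q"
    and "\<forall>x\<in>set p. j \<le> f x" "\<forall>x\<in>set q. f x \<le> j"
    using sorted j by (auto simp: w sorted_wrt_append)
  \<comment> \<open>One of the three blocks is empty on each side of the good letter, so the letters
    of value \<open>j\<close> form a suffix of \<open>p\<close> and a prefix of
    \<open>q\<close>.\<close>
  moreover from this have "filter (\<lambda>x. f x < j) p = []" "filter (\<lambda>x. j < f x) q = []"
    by (force simp: filter_empty_conv)+
  ultimately have "filter (\<lambda>x. j < f x) p @ filter (\<lambda>x. f x = j) p = p"
    "filter (\<lambda>x. f x = j) q @ filter (\<lambda>x. f x < j) q = q"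
    using sorted_filter_trichotomy[of f p j] sorted_filter_trichotomy[of f q j] by simp_all
  then obtain as' rs' where "scan (filter (\<lambda>x. f x = j) p) = map (Pair LetA) as'"
    "scan (filter (\<lambda>x. f x = j) q) = map (Pair LetR) rs'"
    using p q scan_suffix_LetA scan_prefix_LetR by metis
  moreover have "filter (\<lambda>x. f x = j) w
      = filter (\<lambda>x. f x = j) p @ (LetA, \<gamma>) # filter (\<lambda>x. f x = j) q"
    using j w by simp
  ultimately show ?thesis using good_eq_Some_iff by blast
qed

lemma scan_map_apsnd: "scan (map (apsnd f) w) = map (apsnd f) (scan w)"
  by (induction w) (auto split: list.split)

lemma good_map_apsnd:
  assumes "good w = Some \<gamma>"
  shows "good (map (apsnd f) w) = Some (f \<gamma>)"
proof -
  obtain p q as rs where *: "w = p @ (LetA, \<gamma>) # q" "scan p = map (Pair LetA) as"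
    "scan q = map (Pair LetR) rs"
    using assms good_eq_Some_iff by blast
  have "scan (map (apsnd f) p) = map (Pair LetA) (map f as)"
    "scan (map (apsnd f) q) = map (Pair LetR) (map f rs)"
    using * by (simp_all add: scan_map_apsnd)
  moreover have "map (apsnd f) w = map (apsnd f) p @ (LetA, f \<gamma>) # map (apsnd f) q"
    using * by simp
  ultimately show ?thesis using good_eq_Some_iff by blast
qed


section \<open>Reversing the components\<close>

text \<open>Follows the index \<open>c\<close> under \<open>rev\<close> on lists of length
  \<open>l\<close>. Subtraction truncates, so the involution property is used under the bound
  \<open>c < l\<close>.\<close>

fun flip_node :: "nat \<Rightarrow> node \<Rightarrow> node" where
  "flip_node l (a, b, c) = (a, b, l - Suc c)"

lemma flip_node_flip_node: "comp_index \<gamma> < l \<Longrightarrow> flip_node l (flip_node l \<gamma>) = \<gamma>"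
  by (cases \<gamma>) auto

lemma comp_index_flip_node: "comp_index (flip_node l \<gamma>) = l - Suc (comp_index \<gamma>)"
  by (cases \<gamma>) auto

lemma inj_on_flip_node: "inj_on (flip_node l) {\<gamma>. comp_index \<gamma> < l}"
  by (rule inj_on_inverseI[of _ "flip_node l"]) (simp add: flip_node_flip_node)

lemma content_rev:
  "comp_index \<gamma> < length s \<Longrightarrow> content (rev s) (flip_node (length s) \<gamma>) = content s \<gamma>"
  by (cases \<gamma>) (auto simp: rev_nth)

lemma nodes_comp_index: "\<gamma> \<in> nodes lam \<Longrightarrow> comp_index \<gamma> < length lam"
  by (cases \<gamma>) (auto simp: nodes_def)

lemma nodes_rev: "nodes (rev lam) = flip_node (length lam) ` nodes lam"
proof -
  \<comment> \<open>Kept general in \<open>\<mu>\<close>: at \<open>rev lam\<close>, together with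
    the involution, it yields the opposite inclusion.\<close>
  have sub: "flip_node (length \<mu>) ` nodes \<mu> \<subseteq> nodes (rev \<mu>)" for \<mu>
    by (auto simp: nodes_def rev_nth)
  have "\<gamma> \<in> flip_node (length lam) ` nodes lam" if "\<gamma> \<in> nodes (rev lam)" for \<gamma>
    using sub[of "rev lam"] that nodes_comp_index[OF that]
    by (intro image_eqI[of _ _ "flip_node (length lam) \<gamma>"]) (auto simp: flip_node_flip_node)
  then show ?thesis using sub by blast
qed

lemma rev_multipartitions: "rev \<mu> \<in> multipartitions l \<longleftrightarrow> \<mu> \<in> multipartitions l"
  by (simp add: multipartitions_def)

lemma length_multipartitions: "\<mu> \<in> multipartitions l \<Longrightarrow> length \<mu> = l"
  by (simp add: multipartitions_def)

lemma addable_comp_index: "addable lam \<gamma> \<Longrightarrow> comp_index \<gamma> < length lam"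
  using add_node_properties[of lam \<gamma>] nodes_comp_index[of \<gamma> "add_node \<gamma> lam"]
  by (simp add: length_multipartitions)

lemma signed_nodes_comp_index: "x \<in> signed_nodes lam \<Longrightarrow> comp_index (snd x) < length lam"
  using addable_comp_index[of lam "snd x"] nodes_comp_index[of "snd x" lam]
  by (cases x) (auto simp: signed_nodes_def removable_def)

lemma nodes_rev_add_node:
  assumes "addable lam \<gamma>"
  shows "nodes (rev (add_node \<gamma> lam)) = insert (flip_node (length lam) \<gamma>) (nodes (rev lam))"
  using add_node_properties[OF assms] by (simp add: nodes_rev length_multipartitions)

text \<open>The reversed witness of addability is a witness again; injectivity of the flip on valid
  component indices keeps the new node outside.\<close>

lemma addable_rev:
  assumes "addable lam \<gamma>"
  shows "addable (rev lam) (flip_node (length lam) \<gamma>)"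
proof -
  have "flip_node (length lam) \<gamma> \<notin> flip_node (length lam) ` nodes lam"
  proof
    assume "flip_node (length lam) \<gamma> \<in> flip_node (length lam) ` nodes lam"
    then obtain \<delta> where \<delta>: "\<delta> \<in> nodes lam" "flip_node (length lam) \<gamma> = flip_node (length lam) \<delta>"
      by blast
    then have "\<gamma> = \<delta>"
      using addable_comp_index[OF assms] nodes_comp_index[OF \<delta>(1)]
      by (metis flip_node_flip_node)
    then show False using \<delta>(1) assms by (simp add: addable_def)
  qed
  then have "flip_node (length lam) \<gamma> \<notin> nodes (rev lam)" by (simp add: nodes_rev)
  moreover have "rev (add_node \<gamma> lam) \<in> multipartitions (length (rev lam))"
    using add_node_properties(1)[OF assms] by (simp add: rev_multipartitions)
  ultimately show ?thesis
    using nodes_rev_add_node[OF assms] unfolding addable_def by blast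
qed

lemma add_node_rev:
  assumes "addable lam \<gamma>"
  shows "add_node (flip_node (length lam) \<gamma>) (rev lam) = rev (add_node \<gamma> lam)"
  using add_node_properties[OF addable_rev[OF assms]] add_node_properties(1)[OF assms]
    nodes_rev_add_node[OF assms]
  by (intro nodes_inject[of _ "length lam"]) (simp_all add: rev_multipartitions)

lemma removable_rev:
  assumes "removable lam \<gamma>"
  shows "removable (rev lam) (flip_node (length lam) \<gamma>)"
proof -
  obtain \<mu> where \<mu>: "\<mu> \<in> multipartitions (length lam)" "nodes \<mu> = nodes lam - {\<gamma>}"
    and \<gamma>: "\<gamma> \<in> nodes lam"
    using assms by (auto simp: removable_def)
  \<comment> \<open>Injectivity of the flip lets the image pass through the set difference, whence
    the removed node is written as an image.\<close>
  have "nodes (rev \<mu>) = nodes (rev lam) - flip_node (length lam) ` {\<gamma>}"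
    unfolding nodes_rev length_multipartitions[OF \<mu>(1)] \<mu>(2)
    using \<gamma> nodes_comp_index by (intro inj_on_image_set_diff[OF inj_on_flip_node[of "length lam"]]) auto
  moreover have "rev \<mu> \<in> multipartitions (length (rev lam))"
    using \<mu>(1) by (simp add: rev_multipartitions)
  moreover have "flip_node (length lam) \<gamma> \<in> nodes (rev lam)"
    using \<gamma> by (simp add: nodes_rev)
  ultimately show ?thesis unfolding removable_def by auto
qed

lemma signed_nodes_rev: "signed_nodes (rev lam) = apsnd (flip_node (length lam)) ` signed_nodes lam"
proof -
  have sub: "apsnd (flip_node (length \<mu>)) ` signed_nodes \<mu> \<subseteq> signed_nodes (rev \<mu>)" for \<mu>
    by (auto simp: signed_nodes_def simp del: flip_node.simps intro: addable_rev removable_rev)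
  have "x \<in> apsnd (flip_node (length lam)) ` signed_nodes lam" if "x \<in> signed_nodes (rev lam)" for x
    using sub[of "rev lam"] that signed_nodes_comp_index[OF that]
    by (intro image_eqI[of _ _ "apsnd (flip_node (length lam)) x"])
      (auto simp: flip_node_flip_node prod_eq_iff)
  then show ?thesis using sub by blast
qed


section \<open>Comparison of the two crystals\<close>

text \<open>Strictly increasing index lists with equal sets coincide, and by
  \<open>signed_nodes_diagonal\<close> the component index determines a signed node of given
  content.\<close>

lemma word_inf_eqI:
  assumes \<mu>: "\<mu> \<in> multipartitions l"
    and w: "set w = {x \<in> signed_nodes \<mu>. content t (snd x) = j}"
      "sorted_wrt (\<lambda>x y. comp_index (snd x) < comp_index (snd y)) w"
  shows "word_inf t j \<mu> = w"
proof -
  let ?k = "\<lambda>x. comp_index (snd x)"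
  note v = word_inf_properties[OF \<mu>, of t j]
  have "map ?k (word_inf t j \<mu>) = map ?k w"
    by (rule strict_sorted_equal) (use v w in \<open>simp_all add: sorted_wrt_map\<close>)
  moreover have "inj_on ?k (set (word_inf t j \<mu>) \<union> set w)"
    using signed_nodes_diagonal[OF \<mu>] by (auto simp: v w intro!: inj_onI)
  ultimately show ?thesis by (rule map_inj_on)
qed

text \<open>At a fixed content \<open>prec_plus\<close> compares component indices alone. The affine
  word lists them decreasingly, and the flip makes them increase.\<close>

lemma word_inf_rev:
  assumes lam: "lam \<in> multipartitions (length s)" and j: "[j = i] (mod int e)"
  shows "word_inf (rev s) j (rev lam)
    = map (apsnd (flip_node (length s))) (filter (\<lambda>x. content s (snd x) = j) (word_aff e s i lam))"
proof (rule word_inf_eqI)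
  let ?w = "filter (\<lambda>x. content s (snd x) = j) (word_aff e s i lam)"
  note w = word_aff_properties[OF lam, where e = e and s = s and i = i]
  note len = length_multipartitions[OF lam]
  \<comment> \<open>The congruence ensures that every signed node of content \<open>j\<close> occurs
    in the word of \<open>i\<close>-nodes.\<close>
  have w': "set ?w = {x \<in> signed_nodes lam. content s (snd x) = j}" using w(1) j by auto
  show "rev lam \<in> multipartitions (length s)" using lam by (simp add: rev_multipartitions)
  have "content (rev s) (snd (apsnd (flip_node (length s)) x)) = content s (snd x)"
    if "x \<in> signed_nodes lam" for x
    using signed_nodes_comp_index[OF that] len by (simp add: content_rev)
  then show "set (map (apsnd (flip_node (length s))) ?w)
    = {x \<in> signed_nodes (rev lam). content (rev s) (snd x) = j}"
    unfolding set_map w' signed_nodes_rev len by (auto simp del: snd_apsnd)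
  have "sorted_wrt (\<lambda>x y. prec_plus s (snd y) (snd x)) ?w"
    using w(2) by (rule sorted_wrt_filter)
  then have "sorted_wrt (\<lambda>x y. comp_index (flip_node (length s) (snd x))
      < comp_index (flip_node (length s) (snd y))) ?w"
  proof (rule sorted_wrt_mono_rel[rotated])
    fix x y
    assume "x \<in> set ?w" "y \<in> set ?w" and prec: "prec_plus s (snd y) (snd x)"
    \<comment> \<open>The bound on the larger index makes the truncated subtraction in
      \<open>flip_node\<close> reverse the order strictly.\<close>
    then have "content s (snd x) = content s (snd y)" "comp_index (snd x) < length s"
      using w' signed_nodes_comp_index[of x lam] len by auto
    then show "comp_index (flip_node (length s) (snd x)) < comp_index (flip_node (length s) (snd y))"
      using prec by (auto simp: prec_plus_def comp_index_flip_node)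
  qed
  then show "sorted_wrt (\<lambda>x y. comp_index (snd x) < comp_index (snd y))
      (map (apsnd (flip_node (length s))) ?w)"
    by (simp add: sorted_wrt_map)
qed

text \<open>The single-arrow comparison: the matching operator is indexed by the exact content of
  the added node, not by the residue \<open>i\<close>.\<close>

lemma good_word_aff:
  assumes lam: "lam \<in> multipartitions (length s)" and g: "good (word_aff e s i lam) = Some \<gamma>"
  shows "addable lam \<gamma>"
    and "f_op (rev s) (content s \<gamma>) (rev lam) = Some (rev (add_node \<gamma> lam))"
proof -
  note w = word_aff_properties[OF lam, where e = e and s = s and i = i]
  have \<gamma>: "addable lam \<gamma>" "[content s \<gamma> = i] (mod int e)"
    using good_in_set[OF g] w(1) by (auto simp: signed_nodes_def)
  \<comment> \<open>\<open>prec_plus\<close> compares contents first, so contents decrease weakly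
    along the affine word, as \<open>good_filter\<close> requires.\<close>
  have "sorted_wrt (\<lambda>x y. content s (snd y) \<le> content s (snd x)) (word_aff e s i lam)"
    by (rule sorted_wrt_mono_rel[OF _ w(2)]) (auto simp: prec_plus_def)
  from good_map_apsnd[OF good_filter[OF g this]]
  have "good (word_inf (rev s) (content s \<gamma>) (rev lam)) = Some (flip_node (length s) \<gamma>)"
    using word_inf_rev[OF lam \<gamma>(2)] by simp
  then show "f_op (rev s) (content s \<gamma>) (rev lam) = Some (rev (add_node \<gamma> lam))"
    using add_node_rev[OF \<gamma>(1)] length_multipartitions[OF lam] by (simp add: f_op_def)
  show "addable lam \<gamma>" by (rule \<gamma>)
qed

text \<open>A component consists of the ends of undirected paths, so preserving directed arrows
  suffices: each step is mapped in whichever direction it is traversed.\<close>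

lemma component_map:
  assumes "w \<in> component V arr v"
    and arr: "\<And>x y. x \<in> V \<Longrightarrow> y \<in> V \<Longrightarrow> arr x y \<Longrightarrow> h x \<in> V' \<and> h y \<in> V' \<and> arr' (h x) (h y)"
  shows "h w \<in> component V' arr' (h v)"
proof -
  have "equivclp (\<lambda>x y. x \<in> V \<and> y \<in> V \<and> arr x y) v w"
    using assms(1) by (simp add: component_def)
  then have "equivclp (\<lambda>x y. x \<in> V' \<and> y \<in> V' \<and> arr' x y) (h v) (h w)"
  proof (induction rule: equivclp_induct)
    case (step y z)
    from step(2) have "equivclp (\<lambda>x y. x \<in> V' \<and> y \<in> V' \<and> arr' x y) (h y) (h z)"
    proof
      assume "y \<in> V \<and> z \<in> V \<and> arr y z"
      then show ?thesis using arr[of y z] by (intro r_into_equivclp) simp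
    next
      assume "z \<in> V \<and> y \<in> V \<and> arr z y"
      then show ?thesis using arr[of z y] by (intro converse_r_into_equivclp) simp
    qed
    then show ?case using step.IH by (rule equivclp_trans[rotated])
  qed simp
  then show ?thesis by (simp add: component_def)
qed

lemma rev_empty_mp: "rev (empty_mp l) = empty_mp l"
  by (simp add: empty_mp_def)

text \<open>The head of \<open>js\<close> acts last, so the induction peels off the final operator.
  Membership is carried along since \<open>good_word_aff\<close> needs it at each intermediate
  vertex.\<close>

lemma apply_ops_rev:
  assumes "apply_ops (F_op e s) js (empty_mp (length s)) = Some lam"
  shows "lam \<in> multipartitions (length s)
    \<and> apply_ops (f_op (rev s)) js (empty_mp (length s)) = Some (rev lam)"
  using assms
proof (induction js arbitrary: lam)
  case Nil
  then show ?case
    by (auto simp: rev_empty_mp) (simp add: empty_mp_def multipartitions_def is_partition_def)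
next
  case (Cons j js)
  then obtain \<mu> where \<mu>: "apply_ops (F_op e s) js (empty_mp (length s)) = Some \<mu>"
    "F_op e s j \<mu> = Some lam"
    by (auto simp: bind_eq_Some_conv)
  then have IH: "\<mu> \<in> multipartitions (length s)"
    "apply_ops (f_op (rev s)) js (empty_mp (length s)) = Some (rev \<mu>)"
    using Cons.IH by auto
  from \<mu>(2) obtain \<gamma> where \<gamma>: "good (word_aff e s (j mod int e) \<mu>) = Some \<gamma>" "content s \<gamma> = j"
    "lam = add_node \<gamma> \<mu>"
    by (auto simp: F_op_def split: option.splits if_splits)
  show ?case
    using good_word_aff[OF IH(1) \<gamma>(1)] \<gamma> IH add_node_properties(1)[of \<mu> \<gamma>]
    by (simp add: length_multipartitions)
qed

theorem theorem4p2p2: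
  fixes e l :: nat and s :: "int list"
  assumes "e > 0" and "l \<ge> 1" and "length s = l"
  shows "rev ` crystal_aff e s \<subseteq> crystal_inf (rev s)
    \<and> inj_on rev (crystal_aff e s)
    \<and> (\<forall>lam\<in>crystal_aff e s. \<forall>js.
         apply_ops (F_op e s) js (empty_mp l) = Some lam
           \<longrightarrow> apply_ops (f_op (rev s)) js (empty_mp l) = Some (rev lam))"
proof (intro conjI ballI allI impI subsetI)
  fix x assume "x \<in> rev ` crystal_aff e s"
  then obtain lam where x: "x = rev lam" and lam: "lam \<in> crystal_aff e s" by blast
  \<comment> \<open>The base point is left as the reversed empty multipartition to match
    \<open>component_map\<close> with \<open>h = rev\<close>.\<close>
  have "rev lam \<in> component (multipartitions (length (rev s)))
     (\<lambda>\<mu> \<nu>. \<exists>j. f_op (rev s) j \<mu> = Some \<nu>) (rev (empty_mp (length s)))"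
    using lam unfolding crystal_aff_def
  proof (rule component_map)
    fix \<mu> \<nu>
    assume *: "\<mu> \<in> multipartitions (length s)" "\<nu> \<in> multipartitions (length s)"
      "\<exists>i\<in>{0..<int e}. arrow_aff e s i \<mu> \<nu>"
    then obtain i \<gamma> where "good (word_aff e s i \<mu>) = Some \<gamma>" "\<nu> = add_node \<gamma> \<mu>"
      unfolding arrow_aff_def by blast
    then have "\<exists>j. f_op (rev s) j (rev \<mu>) = Some (rev \<nu>)"
      using good_word_aff(2)[OF *(1)] by blast
    then show "rev \<mu> \<in> multipartitions (length (rev s)) \<and> rev \<nu> \<in> multipartitions (length (rev s))
      \<and> (\<exists>j. f_op (rev s) j (rev \<mu>) = Some (rev \<nu>))"
      using * by (simp add: rev_multipartitions)
  qed
  then show "x \<in> crystal_inf (rev s)" by (simp add: x crystal_inf_def rev_empty_mp)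
next
  show "inj_on rev (crystal_aff e s)" by simp
next
  fix lam js
  assume "apply_ops (F_op e s) js (empty_mp l) = Some lam"
  then show "apply_ops (f_op (rev s)) js (empty_mp l) = Some (rev lam)"
    using apply_ops_rev assms(3) by blast
qed

end
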